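(* Let $k \geq \ell \geq 5$ and $n \geq \lceil \frac{k+\ell-2}{2} \rceil$. Then $$sat(K_k^n,C_{\ell}) \leq kn+k+ \ell-5 + \left\lfloor \frac{\ell-4}{2} \right\rfloor ^2 + 2 \left( \ell-4-2 \left\lfloor \frac{\ell-4}{2} \right\rfloor \right) \left\lfloor \frac{\ell-4}{2} \right\rfloor,$$ that is, $sat(K_k^n,C_{\ell}) \le kn+k+\frac{\ell^2-2\ell-15}{4}$ if $\ell$ is odd and $sat(K_k^n,C_{\ell}) \le kn+k+\frac{\ell^2-4\ell-4}{4}$ if $\ell$ is even.
   Context: All graphs are finite, simple and undirected. $K_k^n$ denotes the complete $k$-partite graph with exactly $n$ vertices in each of its $k$ parts. $C_\ell$ denotes the cycle on $\ell$ vertices. For graphs $G$ and $F$, a spanning subgraph $H$ of $G$ is $F$-saturated relative to $G$ if $H$ contains no copy of $F$ but $H+e$ contains a copy of $F$ for every $e\in E(G)\setminus E(H)$; $sat(G,F)$ is the minimum number of edges of a graph that is $F$-saturated relative to $G$. *)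

theory Defs
  imports Complex_Main
begin

type_synonym 'a ugraph = "'a set \<times> 'a set set"

abbreviation verts :: "'a ugraph \<Rightarrow> 'a set" where
  "verts G \<equiv> fst G"

abbreviation edges :: "'a ugraph \<Rightarrow> 'a set set" where
  "edges G \<equiv> snd G"

definition finite_simple_graph :: "'a ugraph \<Rightarrow> bool" where
  "finite_simple_graph G \<longleftrightarrow>
     finite (verts G) \<and> (\<forall>e\<in>edges G. e \<subseteq> verts G \<and> card e = 2)"

definition add_edge :: "'a ugraph \<Rightarrow> 'a set \<Rightarrow> 'a ugraph" where
  "add_edge H e = (verts H, insert e (edges H))"

definition spanning_subgraph :: "'a ugraph \<Rightarrow> 'a ugraph \<Rightarrow> bool" where
  "spanning_subgraph H G \<longleftrightarrow> verts H = verts G \<and> edges H \<subseteq> edges G"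

text \<open>A copy is a not necessarily induced subgraph isomorphic to the given graph.\<close>

definition contains_copy :: "'a ugraph \<Rightarrow> 'b ugraph \<Rightarrow> bool" where
  "contains_copy H F \<longleftrightarrow>
     (\<exists>f. inj_on f (verts F) \<and> f ` verts F \<subseteq> verts H \<and> (\<forall>e\<in>edges F. f ` e \<in> edges H))"

definition saturated :: "'a ugraph \<Rightarrow> 'b ugraph \<Rightarrow> 'a ugraph \<Rightarrow> bool" where
  "saturated G F H \<longleftrightarrow>
     spanning_subgraph H G \<and> \<not> contains_copy H F \<and>
     (\<forall>e\<in>edges G - edges H. contains_copy (add_edge H e) F)"

text \<open>The minimum is attained whenever the host graph is finite and the forbidden graph has an
  edge: see \<open>saturated_exists\<close> and \<open>sat_attained\<close> below.\<close>

definition sat :: "'a ugraph \<Rightarrow> 'b ugraph \<Rightarrow> nat" where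
  "sat G F = (LEAST m. \<exists>H. saturated G F H \<and> m = card (edges H))"

text \<open>The vertex \<open>(i, a)\<close> is the \<open>a\<close>-th vertex of the \<open>i\<close>-th part.\<close>

definition complete_multipartite :: "nat \<Rightarrow> nat \<Rightarrow> (nat \<times> nat) ugraph" where
  "complete_multipartite k n =
     ({..<k} \<times> {..<n},
      {{(i, a), (j, b)} | i a j b. i < k \<and> j < k \<and> a < n \<and> b < n \<and> i \<noteq> j})"

text \<open>This is the cycle on \<open>l\<close> vertices for \<open>l \<ge> 3\<close> only.\<close>

definition cycle :: "nat \<Rightarrow> nat ugraph" where
  "cycle l = ({..<l}, {{i, Suc i mod l} | i. i < l})"

lemma finite_simple_graph_complete_multipartite:
  "finite_simple_graph (complete_multipartite k n)"
  unfolding finite_simple_graph_def complete_multipartite_def by (auto simp: card_insert_if)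

lemma finite_simple_graph_cycle:
  assumes "l \<ge> 3"
  shows "finite_simple_graph (cycle l)"
proof -
  have "i \<noteq> Suc i mod l \<and> Suc i mod l < l" if "i < l" for i
    using assms that by (cases "Suc i = l") auto
  then show ?thesis
    unfolding finite_simple_graph_def cycle_def by (fastforce simp: card_insert_if)
qed

lemma saturated_exists:
  assumes "finite_simple_graph G" and "edges F \<noteq> {}"
  shows "\<exists>H. saturated G F H"
proof -
  let ?A = "{S. S \<subseteq> edges G \<and> \<not> contains_copy (verts G, S) F}"
  have "edges G \<subseteq> Pow (verts G)" "finite (verts G)"
    using assms(1) by (auto simp: finite_simple_graph_def)
  then have "finite (edges G)"
    by (meson finite_Pow_iff finite_subset)
  then have "finite ?A"
    by auto
  moreover have "{} \<in> ?A"
    using assms(2) unfolding contains_copy_def by simp blast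
  ultimately obtain S where "S \<in> ?A" and max: "\<forall>T\<in>?A. S \<subseteq> T \<longrightarrow> S = T"
    using finite_has_maximal[of ?A] by (metis (no_types, lifting) empty_iff)
  then have S: "S \<subseteq> edges G" "\<not> contains_copy (verts G, S) F"
    by simp_all
  have "contains_copy (verts G, insert e S) F" if e: "e \<in> edges G - S" for e
  proof (rule ccontr)
    assume "\<not> ?thesis"
    with S(1) e have "insert e S \<in> ?A"
      by simp
    with max have "S = insert e S"
      by (meson subset_insertI)
    with e show False
      by blast
  qed
  with S have "saturated G F (verts G, S)"
    unfolding saturated_def spanning_subgraph_def add_edge_def by simp
  then show ?thesis ..
qed

lemma sat_attained:
  assumes "finite_simple_graph G" and "edges F \<noteq> {}"
  shows "\<exists>H. saturated G F H \<and> card (edges H) = sat G F"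
proof -
  have "\<exists>m H. saturated G F H \<and> m = card (edges H)"
    using saturated_exists[OF assms] by blast
  from LeastI_ex[OF this] show ?thesis
    unfolding sat_def by metis
qed

end

theory Submission
  imports Defs
begin

text \<open>
  Take a complete multipartite graph \<open>R\<close> on \<open>l - 4\<close> vertices in which every vertex ends a
  Hamiltonian path (\<open>K\<^sub>m\<^sub>,\<^sub>m\<close> or \<open>K\<^sub>1\<^sub>,\<^sub>m\<^sub>,\<^sub>m\<close> with \<open>m = \<lfloor>(l - 4) / 2\<rfloor>\<close>), two adjacent hubs \<open>a\<close>, \<open>b\<close> joined
  to all of \<open>R\<close>, and for each part \<open>i\<close> an anchor \<open>u i\<close> outside part \<open>i\<close> joined to both hubs. All
  other vertices of part \<open>i\<close> become pendant at \<open>u i\<close>. A cycle avoids the pendant vertices and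
  meets an anchor only between the two hubs, so a cycle through two anchors has length 4, and any
  other cycle has at most \<open>(l - 2) + 1\<close> vertices. Conversely, hub-to-hub paths through \<open>R\<close> can be
  given any number of inner vertices from 0 to \<open>l - 4\<close>; these and the Hamiltonian paths of \<open>R\<close> close
  every missing edge to an \<open>l\<close>-cycle (only for \<open>l = 5\<close>, two pendant vertices need a path through a
  single hub).
\<close>

section \<open>Closing paths to cycles, and the graph over an abstract colouring\<close>

lemma contains_cycle_of_path:
  assumes "distinct xs" "set xs \<subseteq> V" "length xs = l" "l \<ge> 3"
    and "successively (\<lambda>x y. {x, y} \<in> E) xs"
    and "{hd xs, last xs} \<in> E"
  shows "contains_copy (V, E) (cycle l)"
  unfolding contains_copy_def
proof (intro exI conjI)
  show "inj_on ((!) xs) (verts (cycle l))"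
    using assms by (simp add: cycle_def inj_on_nth)
  show "(!) xs ` verts (cycle l) \<subseteq> verts (V, E)"
    using assms by (auto simp: cycle_def)
  have "{xs ! i, xs ! (Suc i mod l)} \<in> E" if "i < l" for i
  proof (cases "Suc i = l")
    case True
    moreover have "xs \<noteq> []"
      using assms by auto
    ultimately have "xs ! i = last xs" "xs ! (Suc i mod l) = hd xs"
      using assms(3) by (auto simp: last_conv_nth hd_conv_nth)
    with assms show ?thesis
      by (simp add: insert_commute)
  next
    case False
    with that assms show ?thesis
      by (auto simp: successively_conv_nth)
  qed
  then show "\<forall>e\<in>edges (cycle l). (!) xs ` e \<in> edges (V, E)"
    by (auto simp: cycle_def)
qed

text \<open>The host graph enters only through the colouring \<open>c\<close>, whose classes are the
  parts, so saturation is proved without coordinates. \<open>R_traceable\<close> prescribes the end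
  \<open>w\<close> of a Hamiltonian path of \<open>R\<close>; this is what closes missing edges at
  vertices of \<open>R\<close>.\<close>

locale hub_graph =
  fixes V R :: "'a set" and c :: "'a \<Rightarrow> 'b" and a b :: 'a and u :: "'b \<Rightarrow> 'a"
  assumes finite_V: "finite V"
    and a: "a \<in> V" and b: "b \<in> V" and ab: "c a \<noteq> c b"
    and R_sub: "R \<subseteq> V" and R_nonempty: "R \<noteq> {}"
    and R_colour: "w \<in> R \<Longrightarrow> c w \<noteq> c a \<and> c w \<noteq> c b"
    and R_traceable: "w \<in> R \<Longrightarrow>
      \<exists>zs. distinct zs \<and> set zs = R \<and> last zs = w \<and> successively (\<lambda>x y. c x \<noteq> c y) zs"
    and u_in: "i \<in> c ` V \<Longrightarrow> u i \<in> V"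
    and u_inj: "inj_on u (c ` V)"
    and u_colour: "i \<in> c ` V \<Longrightarrow> c (u i) \<noteq> c a \<and> c (u i) \<noteq> c b \<and> c (u i) \<noteq> i"
    and u_R: "i \<in> c ` V \<Longrightarrow> u i \<notin> R"
begin

definition U :: "'a set" where
  "U = u ` c ` V"

definition pendants :: "'a set" where
  "pendants = V - ({a, b} \<union> R \<union> U)"

definition host :: "'a set set" where
  "host = {{x, y} | x y. x \<in> V \<and> y \<in> V \<and> c x \<noteq> c y}"

definition inner :: "'a set set" where
  "inner = {{x, y} | x y. x \<in> R \<and> y \<in> R \<and> c x \<noteq> c y}"

text \<open>Each pendant vertex hangs at the anchor of its own part. As \<open>u\<close> is
  injective on colours, pendants with a common anchor lie in one part, so no host edge between them
  is left to close.\<close>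

definition E :: "'a set set" where
  "E = insert {a, b} ({{h, y} | h y. h \<in> {a, b} \<and> y \<in> R \<union> U} \<union> inner
         \<union> (\<lambda>x. {x, u (c x)}) ` pendants)"

lemma U_sub: "U \<subseteq> V" and U_not: "a \<notin> U" "b \<notin> U" "U \<inter> R = {}"
  using u_in u_colour u_R by (auto simp: U_def)

lemma R_not: "a \<notin> R" "b \<notin> R"
  using R_colour by blast+

lemma a_noteq_b: "a \<noteq> b"
  using ab by auto

lemma u_colour_in_U: "x \<in> V \<Longrightarrow> u (c x) \<in> U"
  by (auto simp: U_def)

lemma vertex_cases [consumes 1, case_names pendant U a b R]:
  assumes "x \<in> V"
  obtains "x \<in> pendants" | "x \<in> U" | "x = a" | "x = b" | "x \<in> R"
  using assms by (auto simp: pendants_def)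

lemma E_sub_host: "E \<subseteq> host"
proof
  fix e assume "e \<in> E"
  then consider "e = {a, b}" | h y where "e = {h, y}" "h \<in> {a, b}" "y \<in> R" 
    | h i where "e = {h, u i}" "h \<in> {a, b}" "i \<in> c ` V"
    | "e \<in> inner" | x where "e = {x, u (c x)}" "x \<in> V"
    unfolding E_def U_def pendants_def by blast
  then show "e \<in> host"
  proof cases
    case 1
    then show ?thesis
      using a b ab unfolding host_def by blast
  next
    case 2
    then have "h \<in> V" "y \<in> V" "c h \<noteq> c y"
      using a b R_sub R_colour[of y] by auto
    with 2 show ?thesis
      unfolding host_def by blast
  next
    case 3
    then have "h \<in> V" "u i \<in> V" "c h \<noteq> c (u i)"
      using a b u_in u_colour[of i] by auto
    with 3 show ?thesis
      unfolding host_def by blast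
  next
    case 4
    then show ?thesis
      using R_sub unfolding inner_def host_def by blast
  next
    case 5
    then have "u (c x) \<in> V" "c x \<noteq> c (u (c x))"
      using u_in u_colour[of "c x"] by auto
    with 5 show ?thesis
      unfolding host_def by blast
  qed
qed

lemma E_pendant: "{x, y} \<in> E \<Longrightarrow> x \<in> pendants \<Longrightarrow> y = u (c x)"
  using u_colour_in_U
  by (auto simp: E_def inner_def doubleton_eq_iff pendants_def)

lemma E_U: "{x, y} \<in> E \<Longrightarrow> x \<in> U \<Longrightarrow> y \<in> {a, b} \<union> pendants"
  using U_not a_noteq_b
  by (auto simp: E_def inner_def doubleton_eq_iff pendants_def)

lemma E_hub: "h \<in> {a, b} \<Longrightarrow> y \<in> R \<union> U \<Longrightarrow> {h, y} \<in> E \<and> {y, h} \<in> E"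
  unfolding E_def by (auto simp: insert_commute)

lemma E_ab: "{a, b} \<in> E" "{b, a} \<in> E"
  by (auto simp: E_def insert_commute)

lemma E_R: "x \<in> R \<Longrightarrow> y \<in> R \<Longrightarrow> c x \<noteq> c y \<Longrightarrow> {x, y} \<in> E"
  unfolding E_def inner_def by blast

lemma E_pendantI: "x \<in> pendants \<Longrightarrow> {x, u (c x)} \<in> E \<and> {u (c x), x} \<in> E"
  unfolding E_def by (auto simp: insert_commute)

section \<open>Absence of the forbidden cycle\<close>

lemma no_cycle: "\<not> contains_copy (V, E) (cycle (card R + 4))"
proof
  define l where "l = card R + 4"
  have fin_R: "finite R"
    using R_sub finite_V finite_subset by blast
  then have l: "l \<ge> 5"
    using R_nonempty by (simp add: l_def Suc_le_eq card_gt_0_iff)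
  \<comment> \<open>\<open>s\<close> is the cyclic successor of positions; a vertex at position
    \<open>s i\<close> has its two cycle neighbours at \<open>i\<close> and
    \<open>s (s i)\<close>.\<close>
  define s where "s i = Suc i mod l" for i
  have s_less: "s i < l" for i
    using l by (simp add: s_def)
  have s_surj: "\<exists>j<l. s j = i" if "i < l" for i
  proof (cases i)
    case 0
    with l show ?thesis
      by (intro exI[of _ "l - 1"]) (simp add: s_def)
  next
    case (Suc j)
    with that show ?thesis
      by (intro exI[of _ j]) (simp add: s_def)
  qed
  have ss: "s (s i) = (i + 2) mod l" for i
    by (simp add: s_def mod_Suc_eq)
  \<comment> \<open>The two cycle neighbours of a vertex are distinct, which rules out vertices of
    degree one.\<close>
  have ss_noteq: "s (s i) \<noteq> i" if "i < l" for i
  proof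
    assume "s (s i) = i"
    then have "(i + 2) mod l = i mod l"
      using that by (simp only: ss mod_less)
    then have "l dvd 2"
      using mod_eq_dvd_iff_nat[of i "i + 2" l] by simp
    with l show False
      by (auto dest: dvd_imp_le)
  qed
  assume "contains_copy (V, E) (cycle (card R + 4))"
  then obtain f where inj: "inj_on f {..<l}" and fV: "f ` {..<l} \<subseteq> V"
    and edges: "\<And>e. e \<in> edges (cycle l) \<Longrightarrow> f ` e \<in> E"
    unfolding contains_copy_def cycle_def l_def by auto
  have f: "{f i, f (s i)} \<in> E" if "i < l" for i
    using edges[of "{i, s i}"] that by (auto simp: cycle_def s_def)
  have f': "{f (s i), f i} \<in> E" if "i < l" for i
    using f[OF that] by (simp add: insert_commute)
  have no_pendant: "f i \<notin> pendants" if i: "i < l" for i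
  proof
    assume pendant: "f i \<in> pendants"
    obtain j where j: "j < l" "s j = i"
      using s_surj[OF i] by blast
    have "f j = u (c (f i))"
      using E_pendant[OF _ pendant] f'[OF j(1)] j(2) by simp
    moreover have "f (s i) = u (c (f i))"
      using E_pendant[OF f[OF i] pendant] .
    ultimately have "j = s i"
      using inj j(1) s_less by (auto simp: inj_on_def)
    with ss_noteq[OF j(1)] j(2) show False
      by simp
  qed
  have U_hubs: "f i \<in> {a, b} \<and> f (s (s i)) \<in> {a, b} \<and> f i \<noteq> f (s (s i))"
    if "i < l" "f (s i) \<in> U" for i
    using E_U[OF f'[of i]] E_U[OF f[of "s i"]] no_pendant[of i] no_pendant[of "s (s i)"]
      that s_less ss_noteq[of i] inj
    by (auto simp: inj_on_def)
  \<comment> \<open>Two anchors on the cycle share both hubs as neighbours, in opposite order, so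
    four steps lead back to the start and \<open>l\<close> divides 4.\<close>
  have one_U: "i = j" if i: "i < l" "f (s i) \<in> U" and j: "j < l" "f (s j) \<in> U" for i j
  proof (rule ccontr)
    assume "i \<noteq> j"
    then have "f i \<noteq> f j"
      using i j inj by (auto simp: inj_on_def)
    with U_hubs[OF i] U_hubs[OF j] have "f (s (s i)) = f j" "f (s (s j)) = f i"
      by auto
    then have "s (s i) = j" "s (s j) = i"
      using i j inj s_less by (auto simp: inj_on_def)
    then have "((i + 2) mod l + 2) mod l = i"
      using ss by metis
    moreover have "((i + 2) mod l + 2) mod l = (i + 2 + 2) mod l"
      by (rule mod_add_left_eq)
    moreover have "i + 2 + 2 = i + 4"
      by simp
    ultimately have "(i + 4) mod l = i mod l"
      using i(1) by (metis mod_less)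
    then have "l dvd 4"
      using mod_eq_dvd_iff_nat[of i "i + 4" l] by simp
    with l show False
      by (auto dest: dvd_imp_le)
  qed
  have "x = y" if xy: "x \<in> f ` {..<l} \<inter> U" "y \<in> f ` {..<l} \<inter> U" for x y
  proof -
    obtain i j where ij: "i < l" "x = f i" "j < l" "y = f j"
      using xy by auto
    obtain i' j' where "i' < l" "s i' = i" "j' < l" "s j' = j"
      using s_surj[OF ij(1)] s_surj[OF ij(3)] by auto
    with one_U[of i' j'] ij xy show ?thesis
      by auto
  qed
  then have "card (f ` {..<l} \<inter> U) \<le> Suc 0"
    by (subst card_le_Suc0_iff_eq) auto
  \<comment> \<open>At most one anchor, two hubs and \<open>R\<close> remain:
    \<open>card R + 3\<close> vertices, one too few.\<close>
  moreover have "f ` {..<l} \<subseteq> (f ` {..<l} \<inter> U) \<union> insert a (insert b R)"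
    using fV no_pendant by (auto simp: pendants_def)
  then have "card (f ` {..<l}) \<le> card ((f ` {..<l} \<inter> U) \<union> insert a (insert b R))"
    using fin_R by (intro card_mono) auto
  moreover have "\<dots> \<le> card (f ` {..<l} \<inter> U) + card (insert a (insert b R))"
    by (rule card_Un_le)
  moreover have "card (insert a (insert b R)) = card R + 2"
    using fin_R R_not a_noteq_b by simp
  moreover have "card (f ` {..<l}) = l"
    using inj by (simp add: card_image)
  ultimately show False
    by (simp add: l_def)
qed

section \<open>Paths that close the missing edges\<close>

lemma R_path:
  assumes "w \<in> R" "q \<le> card R"
  obtains zs where "distinct zs" "set zs \<subseteq> R" "length zs = q"
    "successively (\<lambda>x y. {x, y} \<in> E) zs" "q = card R \<Longrightarrow> last zs = w"
proof -
  obtain zs where zs: "distinct zs" "set zs = R" "last zs = w" "successively (\<lambda>x y. c x \<noteq> c y) zs"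
    using R_traceable assms by blast
  then have len: "length zs = card R"
    using distinct_card by metis
  have "successively (\<lambda>x y. {x, y} \<in> E) zs"
    using zs(4) by (rule successively_mono) (use E_R zs(2) in auto)
  \<comment> \<open>A prefix of a path is a path, but truncation loses the end \<open>w\<close>;
    hence the last vertex is known only for \<open>q = card R\<close>.\<close>
  then have "successively (\<lambda>x y. {x, y} \<in> E) (take q zs)"
    by (auto simp: successively_conv_nth)
  with zs len assms that[of "take q zs"] show ?thesis
    by (auto dest: in_set_takeD)
qed

text \<open>Both hubs see all of \<open>R\<close>, so any path inside \<open>R\<close> can be capped
  by them; for \<open>q = 0\<close> the edge between the hubs takes over. The free length
  \<open>q\<close> is used to tune the lengths of the closing paths.\<close>

lemma R_path_between_hubs:
  assumes "q \<le> card R" "{h, h'} = {a, b}"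
  obtains zs where "distinct zs" "set zs \<subseteq> R" "length zs = q"
    "successively (\<lambda>x y. {x, y} \<in> E) (h # zs @ [h'])"
proof -
  obtain w where "w \<in> R"
    using R_nonempty by blast
  with assms(1) obtain zs where zs: "distinct zs" "set zs \<subseteq> R" "length zs = q"
    "successively (\<lambda>x y. {x, y} \<in> E) zs"
    using R_path by metis
  have "{h, h'} \<in> E"
    using E_ab assms(2) by metis
  moreover have "{h, x} \<in> E" "{x, h'} \<in> E" if "x \<in> set zs" for x
    using that zs(2) assms(2) E_hub[of h x] E_hub[of h' x] by auto
  ultimately have "successively (\<lambda>x y. {x, y} \<in> E) (h # zs @ [h'])"
    using zs(4) by (cases "zs = []") (auto simp: successively_append_iff successively_Cons hd_append)
  with zs that show ?thesis
    by blast
qed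

text \<open>The length is the number of vertices of the forbidden cycle, so a new edge joining the
  two ends closes such a path to a copy of it.\<close>

definition path_between :: "'a \<Rightarrow> 'a \<Rightarrow> bool" where
  "path_between x y \<longleftrightarrow> (\<exists>xs. distinct xs \<and> set xs \<subseteq> V \<and> length xs = card R + 4 \<and>
     successively (\<lambda>x y. {x, y} \<in> E) xs \<and> hd xs = x \<and> last xs = y)"

lemma path_betweenI:
  assumes "distinct xs" "set xs \<subseteq> V" "length xs = card R + 4"
    "successively (\<lambda>x y. {x, y} \<in> E) xs" "hd xs = x" "last xs = y"
  shows "path_between x y"
  using assms unfolding path_between_def by blast

lemma path_pendant_pendant:
  assumes "x \<in> pendants" "y \<in> pendants" "c x \<noteq> c y"
  shows "path_between x y"
proof -
  have V: "x \<in> V" "y \<in> V"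
    using assms by (auto simp: pendants_def)
  then have "u (c x) \<noteq> u (c y)"
    using u_inj assms(3) by (auto simp: inj_on_def)
  note facts = this V assms E_pendantI[OF assms(1)] E_pendantI[OF assms(2)]
    u_colour_in_U[OF V(1)] u_colour_in_U[OF V(2)] U_not R_not a b U_sub R_sub a_noteq_b
  show ?thesis
  proof (cases "card R = 1")
    case True
    \<comment> \<open>The general route has six vertices outside \<open>R\<close>, already more than
      the five needed here; one hub between the two anchors gives exactly five.\<close>
    show ?thesis
      by (rule path_betweenI[of "[x, u (c x), a, u (c y), y]"])
        (use facts True E_hub in \<open>auto simp: pendants_def\<close>)
  next
    case False
    moreover have "card R \<noteq> 0"
      using R_nonempty R_sub finite_V finite_subset by fastforce
    ultimately have R: "card R \<ge> 2"
      by simp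
    obtain zs where zs: "distinct zs" "set zs \<subseteq> R" "length zs = card R - 2"
      "successively (\<lambda>x y. {x, y} \<in> E) (a # zs @ [b])"
      using R_path_between_hubs[of "card R - 2" a b] by auto
    \<comment> \<open>Six vertices outside \<open>R\<close> and \<open>card R - 2\<close> inside
      it.\<close>
    show ?thesis
      by (rule path_betweenI[of "x # u (c x) # (a # zs @ [b]) @ [u (c y), y]"])
        (use facts R zs E_hub in
          \<open>auto simp: pendants_def successively_append_iff successively_Cons hd_append\<close>)
  qed
qed

lemma path_pendant_U:
  assumes "x \<in> pendants" "y \<in> U" "y \<noteq> u (c x)"
  shows "path_between x y"
proof -
  have V: "x \<in> V"
    using assms by (auto simp: pendants_def)
  have "card R \<noteq> 0"
    using R_nonempty R_sub finite_V finite_subset by fastforce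
  moreover obtain zs where zs: "distinct zs" "set zs \<subseteq> R" "length zs = card R - 1"
    "successively (\<lambda>x y. {x, y} \<in> E) (a # zs @ [b])"
    using R_path_between_hubs[of "card R - 1" a b] by auto
  ultimately show ?thesis
    using V assms E_pendantI[OF assms(1)] u_colour_in_U[OF V] U_not R_not a b U_sub R_sub
      a_noteq_b E_hub
    by (intro path_betweenI[of "x # u (c x) # (a # zs @ [b]) @ [y]"])
      (auto simp: pendants_def successively_append_iff successively_Cons hd_append)
qed

text \<open>The path has to finish at \<open>h\<close>, so it enters through the other hub
  \<open>h'\<close> and crosses all of \<open>R\<close> on the way.\<close>

lemma path_pendant_hub:
  assumes "x \<in> pendants" "{h, h'} = {a, b}"
  shows "path_between x h"
proof -
  have V: "x \<in> V" "h \<in> V" "h' \<in> V"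
    using assms a b by (auto simp: pendants_def doubleton_eq_iff)
  have h: "h \<in> {a, b}" "h' \<in> {a, b}" "h \<noteq> h'"
    using assms a_noteq_b by (auto simp: doubleton_eq_iff)
  have "{h', h} = {a, b}"
    using assms(2) by (simp add: insert_commute)
  then obtain zs where zs: "distinct zs" "set zs \<subseteq> R" "length zs = card R"
    "successively (\<lambda>x y. {x, y} \<in> E) (h' # zs @ [h])"
    using R_path_between_hubs[OF order_refl] by blast
  then show ?thesis
    using V h assms(1) E_pendantI[OF assms(1)] u_colour_in_U[OF V(1)] U_not R_not U_sub R_sub
      E_hub[of h' "u (c x)"]
    by (intro path_betweenI[of "x # u (c x) # (h' # zs @ [h])"])
      (auto simp: pendants_def successively_append_iff successively_Cons hd_append)
qed

text \<open>All of \<open>R\<close> is traversed after both hubs, which needs a Hamiltonian path of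
  \<open>R\<close> with the prescribed end \<open>w\<close>.\<close>

lemma path_pendant_R:
  assumes "x \<in> pendants" "w \<in> R"
  shows "path_between x w"
proof -
  have V: "x \<in> V"
    using assms by (auto simp: pendants_def)
  obtain zs where zs: "distinct zs" "set zs \<subseteq> R" "length zs = card R"
    "successively (\<lambda>x y. {x, y} \<in> E) zs" "last zs = w"
    using R_path[OF assms(2), of "card R"] by auto
  moreover have "zs \<noteq> []"
    using zs(3) R_nonempty R_sub finite_V finite_subset by fastforce
  moreover have "hd zs \<in> R"
    using calculation by auto
  ultimately show ?thesis
    using V assms E_pendantI[OF assms(1)] u_colour_in_U[OF V] U_not R_not a b U_sub R_sub
      a_noteq_b E_hub E_ab
    by (intro path_betweenI[of "x # u (c x) # a # b # zs"])
      (auto simp: pendants_def successively_Cons)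
qed

lemma path_U_U:
  assumes "x \<in> U" "y \<in> U" "x \<noteq> y"
  shows "path_between x y"
proof -
  obtain zs where zs: "distinct zs" "set zs \<subseteq> R" "length zs = card R"
    "successively (\<lambda>x y. {x, y} \<in> E) (a # zs @ [b])"
    using R_path_between_hubs[of "card R" a b] by auto
  then show ?thesis
    using assms U_not R_not a b U_sub R_sub a_noteq_b E_hub
    by (intro path_betweenI[of "x # (a # zs @ [b]) @ [y]"])
      (auto simp: successively_append_iff successively_Cons hd_append)
qed

lemma path_U_R:
  assumes "x \<in> U" "w \<in> R"
  shows "path_between x w"
proof -
  \<comment> \<open>Going from \<open>x\<close> over both hubs into \<open>R\<close> is one vertex
    short. A second anchor \<open>y\<close> between the hubs fills the gap; it exists because the
    hubs have different colours.\<close>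
  have "u (c a) \<noteq> u (c b)"
    using u_inj a b ab by (auto simp: inj_on_def)
  then obtain y where y: "y \<in> U" "y \<noteq> x"
    using u_colour_in_U[OF a] u_colour_in_U[OF b] by metis
  obtain zs where zs: "distinct zs" "set zs \<subseteq> R" "length zs = card R"
    "successively (\<lambda>x y. {x, y} \<in> E) zs" "last zs = w"
    using R_path[OF assms(2), of "card R"] by auto
  moreover have "zs \<noteq> []"
    using zs(3) R_nonempty R_sub finite_V finite_subset by fastforce
  moreover have "hd zs \<in> R"
    using calculation by auto
  ultimately show ?thesis
    using y assms U_not R_not a b U_sub R_sub a_noteq_b E_hub
    by (intro path_betweenI[of "x # a # y # b # zs"])
      (auto simp: successively_Cons)
qed

text \<open>The pairs are split by the kinds of their ends. A hub misses only pendant vertices. The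
  direction of the path is immaterial since edges are unordered.\<close>

lemma path_exists:
  assumes "x \<in> V" "y \<in> V" "c x \<noteq> c y" "{x, y} \<notin> E"
  shows "path_between x y \<or> path_between y x"
  using assms(1)
proof (cases rule: vertex_cases)
  case pendant
  note x = this
  show ?thesis
    using assms(2)
  proof (cases rule: vertex_cases)
    case pendant
    with x assms show ?thesis
      by (simp add: path_pendant_pendant)
  next
    case U
    with x assms show ?thesis
      using path_pendant_U E_pendantI by blast
  next
    case a
    with x show ?thesis
      using path_pendant_hub by blast
  next
    case b
    with x show ?thesis
      using path_pendant_hub[of x b a] by (simp add: insert_commute)
  next
    case R
    with x show ?thesis
      by (simp add: path_pendant_R)
  qed
next
  case U
  note x = this
  show ?thesis
    using assms(2)
  proof (cases rule: vertex_cases)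
    case pendant
    with x assms show ?thesis
      using path_pendant_U E_pendantI by blast
  next
    case U
    with x assms show ?thesis
      using path_U_U by blast
  next
    case R
    with x show ?thesis
      by (simp add: path_U_R)
  qed (use x assms E_hub in auto)
next
  case a
  note x = this
  from assms(2) show ?thesis
    by (cases rule: vertex_cases) (use x assms path_pendant_hub E_hub E_ab in auto)
next
  case b
  note x = this
  from assms(2) show ?thesis
    by (cases rule: vertex_cases)
      (use x assms path_pendant_hub E_hub E_ab in \<open>auto simp: insert_commute\<close>)
next
  case R
  note x = this
  show ?thesis
    using assms(2)
  proof (cases rule: vertex_cases)
    case pendant
    with x show ?thesis
      by (simp add: path_pendant_R)
  next
    case U
    with x show ?thesis
      by (simp add: path_U_R)
  next
    case R
    with x assms show ?thesis
      using E_R by blast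
  qed (use x assms E_hub in auto)
qed

theorem saturated_hub_graph: "saturated (V, host) (cycle (card R + 4)) (V, E)"
  unfolding saturated_def
proof (intro conjI ballI)
  show "spanning_subgraph (V, E) (V, host)"
    using E_sub_host by (simp add: spanning_subgraph_def)
  show "\<not> contains_copy (V, E) (cycle (card R + 4))"
    by (rule no_cycle)
  fix e assume "e \<in> edges (V, host) - edges (V, E)"
  then obtain x y where e: "e = {x, y}" "x \<in> V" "y \<in> V" "c x \<noteq> c y" "{x, y} \<notin> E"
    unfolding host_def by auto
  then obtain xs where xs: "distinct xs" "set xs \<subseteq> V" "length xs = card R + 4"
    "successively (\<lambda>x y. {x, y} \<in> E) xs" "{hd xs, last xs} = e"
    using path_exists[OF e(2-5)] unfolding path_between_def by (auto simp: insert_commute)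
  from xs(4) have "successively (\<lambda>x y. {x, y} \<in> insert e E) xs"
    by (rule successively_mono) auto
  with xs contains_cycle_of_path[of xs V "card R + 4" "insert e E"]
  show "contains_copy (add_edge (V, E) e) (cycle (card R + 4))"
    by (simp add: add_edge_def)
qed

section \<open>Counting the edges\<close>

lemma card_E_le: "card E \<le> card V + card (c ` V) + card R + card inner - 1"
proof -
  have fin: "finite R" "finite U" "finite pendants"
    using finite_V R_sub U_sub by (auto simp: pendants_def intro: finite_subset)
  have card_U: "card U = card (c ` V)"
    using u_inj by (simp add: U_def card_image)
  define Q where "Q = {a, b} \<union> R \<union> U"
  have "card Q = 2 + card R + card U"
    unfolding Q_def using fin U_not R_not a_noteq_b by (subst card_Un_disjoint) auto
  moreover have "V \<inter> Q = Q"
    using a b R_sub U_sub by (auto simp: Q_def)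
  moreover have "pendants = V - Q"
    by (simp add: pendants_def Q_def)
  ultimately have V: "card V = card pendants + (2 + card R + card U)"
    using card_Int_Diff[OF finite_V, of Q] by simp
  define H where "H = (\<lambda>(h, y). {h, y}) ` ({a, b} \<times> (R \<union> U))"
  define P where "P = (\<lambda>x. {x, u (c x)}) ` pendants"
  have "E = insert {a, b} (H \<union> inner \<union> P)"
    unfolding E_def H_def P_def by auto
  then have "card E \<le> Suc (card (H \<union> inner \<union> P))"
    by (auto intro: card_insert_le_m1)
  moreover have "card H \<le> card ({a, b} \<times> (R \<union> U))"
    unfolding H_def using fin by (intro card_image_le) auto
  moreover have "card ({a, b} \<times> (R \<union> U)) = 2 * (card R + card U)"
    using fin U_not(3) a_noteq_b by (simp add: card_cartesian_product card_Un_disjoint Int_commute)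
  moreover have "card P \<le> card pendants"
    unfolding P_def using fin by (intro card_image_le)
  \<comment> \<open>One edge between the hubs, two for each vertex of \<open>R\<close> and each
    anchor, one for each pendant vertex. Trading the pendants for \<open>card V\<close> absorbs one
    copy of \<open>card R + card U\<close> and leaves the \<open>- 1\<close>.\<close>
  ultimately have "card E \<le> 1 + 2 * (card R + card U) + card inner + card pendants"
    using card_Un_le[of "H \<union> inner" P] card_Un_le[of H inner] by linarith
  with V card_U show ?thesis
    by simp
qed

end

section \<open>Coordinates in the complete multipartite graph\<close>

text \<open>Part of the \<open>i\<close>-th vertex of \<open>R\<close>: the parts 2 and 3 alternate, and for odd \<open>p\<close> the last
  vertex is alone in part 4, so that the vertices can be traversed cyclically.\<close>

definition rim_part :: "nat \<Rightarrow> nat \<Rightarrow> nat" where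
  "rim_part p i = (if Suc i = p \<and> even i then 4 else 2 + i mod 2)"

definition rim :: "nat \<Rightarrow> nat \<Rightarrow> nat \<times> nat" where
  "rim p i = (rim_part p i, i div 2)"

text \<open>Shifting the part by two, with the last two parts wrapped around to parts 2 and 3, keeps the
  anchors away from parts 0 and 1 of the hubs and spreads them so that no part gets more than two.\<close>

definition anchor :: "nat \<Rightarrow> nat \<Rightarrow> nat \<Rightarrow> nat \<times> nat" where
  "anchor k n i = (if i + 2 < k then (i + 2, n - 1) else (i + 4 - k, n - 2))"

lemma rim_part_Suc: "Suc i < p \<Longrightarrow> rim_part p i \<noteq> rim_part p (Suc i)"
  by (auto simp: rim_part_def mod_Suc)

lemma rim_part_last:
  assumes "p > 1"
  shows "rim_part p (p - 1) \<noteq> rim_part p 0"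
proof -
  have "(p - 1) mod 2 = 1" if "even p"
    using that assms by presburger
  with assms show ?thesis
    by (cases "even p") (auto simp: rim_part_def)
qed

lemma rim_part_ge: "rim_part p i \<ge> 2" and rim_part_le: "rim_part p i \<le> 4"
  by (auto simp: rim_part_def)

lemma inj_rim: "inj_on (rim p) {..<p}"
proof (rule inj_onI)
  fix i j assume "i \<in> {..<p}" "j \<in> {..<p}" and eq: "rim p i = rim p j"
  have "i mod 2 < 2" "j mod 2 < 2"
    by simp_all
  with eq have "i mod 2 = j mod 2" "i div 2 = j div 2"
    by (auto simp: rim_def rim_part_def even_iff_mod_2_eq_zero split: if_splits)
  then show "i = j"
    by (metis div_mult_mod_eq)
qed

lemma rim_traceable:
  assumes "j < p"
  shows "\<exists>zs. distinct zs \<and> set zs = rim p ` {..<p} \<and> last zs = rim p j \<and>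
    successively (\<lambda>x y. fst x \<noteq> fst y) zs"
proof (intro exI conjI)
  \<comment> \<open>Consecutive rim vertices differ in part also across the wrap-around, so the
    cyclic order may be rotated until it ends at \<open>j\<close>.\<close>
  let ?is = "[Suc j..<p] @ [0..<Suc j]"
  have set: "set ?is = {..<p}" and dist: "distinct ?is"
    using assms by auto
  show "set (map (rim p) ?is) = rim p ` {..<p}"
    by (simp only: set set_map)
  show "distinct (map (rim p) ?is)"
    using dist inj_rim by (simp only: set distinct_map)
  show "last (map (rim p) ?is) = rim p j"
    by simp
  have upt: "successively (\<lambda>x y. rim_part p x \<noteq> rim_part p y) [i..<i']" if "i' \<le> p" for i i'
    using that rim_part_Suc by (auto simp: successively_conv_nth)
  have "rim_part p (last [Suc j..<p]) \<noteq> rim_part p (hd [0..<Suc j])" if "Suc j < p"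
    using that rim_part_last[of p] by (simp add: hd_append)
  then have "successively (\<lambda>x y. rim_part p x \<noteq> rim_part p y) ?is"
    using upt[of p "Suc j"] upt[of "Suc j" 0] assms
    by (auto simp: successively_append_iff simp del: upt_Suc)
  then show "successively (\<lambda>x y. fst x \<noteq> fst y) (map (rim p) ?is)"
    by (simp only: successively_map rim_def fst_conv)
qed

text \<open>The wrapped part \<open>i + 4 - k\<close> differs from \<open>i\<close> because k > 4.
  The lower bound on the second coordinate separates the anchors from the rim.\<close>

lemma anchor_props:
  assumes "i < k" "k \<ge> 5" "n \<ge> 2"
  shows "fst (anchor k n i) < k" "snd (anchor k n i) < n" "fst (anchor k n i) \<ge> 2"
    "fst (anchor k n i) \<noteq> i" "snd (anchor k n i) \<ge> n - 2"
  using assms by (auto simp: anchor_def)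

lemma inj_anchor: "n \<ge> 2 \<Longrightarrow> inj_on (anchor k n) {..<k}"
  by (rule inj_onI) (auto simp: anchor_def split: if_splits)

lemma hub_graph_multipartite:
  assumes "k \<ge> 5" "p \<ge> 1" "n \<ge> p + 3"
  shows "hub_graph ({..<k} \<times> {..<n}) (rim p ` {..<p}) fst (0, 0) (1, 0) (anchor k n)"
proof
  have fst: "fst ` ({..<k} \<times> {..<n}) = {..<k}"
    using assms by (simp add: fst_image_times lessThan_empty_iff)
  show "rim p ` {..<p} \<subseteq> {..<k} \<times> {..<n}"
    using assms rim_part_le[of p] by (fastforce simp: rim_def intro: le_less_trans)
  show "fst w \<noteq> fst (0::nat, 0::nat) \<and> fst w \<noteq> fst (1::nat, 0::nat)"
    if w: "w \<in> rim p ` {..<p}" for w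
  proof -
    obtain i where "w = rim p i"
      using w by blast
    with rim_part_ge[of p i] show ?thesis
      by (auto simp: rim_def)
  qed
  show "\<exists>zs. distinct zs \<and> set zs = rim p ` {..<p} \<and> last zs = w \<and>
      successively (\<lambda>x y. fst x \<noteq> fst y) zs" if "w \<in> rim p ` {..<p}" for w
    using that rim_traceable by auto
  show "inj_on (anchor k n) (fst ` ({..<k} \<times> {..<n}))"
    unfolding fst using assms by (intro inj_anchor) simp
  fix i assume "i \<in> fst ` ({..<k} \<times> {..<n})"
  then have "i < k"
    unfolding fst by simp
  note anchor = anchor_props[OF this assms(1), of n]
  show "anchor k n i \<in> {..<k} \<times> {..<n}"
    using anchor assms by (cases "anchor k n i") auto
  show "fst (anchor k n i) \<noteq> fst (0::nat, 0::nat) \<and>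
      fst (anchor k n i) \<noteq> fst (1::nat, 0::nat) \<and> fst (anchor k n i) \<noteq> i"
    using anchor assms by auto
  show "anchor k n i \<notin> rim p ` {..<p}"
  proof
    assume "anchor k n i \<in> rim p ` {..<p}"
    then obtain j where "j < p" "anchor k n i = rim p j"
      by auto
    \<comment> \<open>Second coordinates on the rim stay below \<open>p\<close>, hence below
      \<open>n - 2\<close>, where the anchors begin.\<close>
    then have "snd (anchor k n i) \<le> j"
      by (simp add: rim_def)
    with \<open>j < p\<close> anchor(5) assms show False
      by linarith
  qed
qed (use assms in \<open>auto simp: lessThan_empty_iff\<close>)

lemma card_inner_rim:
  fixes p m :: nat
  defines "m \<equiv> p div 2"
  shows "card {{x, y} | x y. x \<in> rim p ` {..<p} \<and> y \<in> rim p ` {..<p} \<and> fst x \<noteq> fst y}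
    \<le> m * m + (p mod 2) * (2 * m)"
proof -
  \<comment> \<open>\<open>A\<close> covers the edges between parts 2 and 3, and \<open>B\<close>
    those at the single vertex of part 4. The factor \<open>{..<p mod 2}\<close> makes
    \<open>B\<close> empty for even \<open>p\<close>.\<close>
  define A where "A = (\<lambda>(i, j). {rim p (2 * i), rim p (2 * j + 1)}) ` ({..<m} \<times> {..<m})"
  define B where "B = (\<lambda>(t, j). {rim p (2 * m), rim p j}) ` ({..<p mod 2} \<times> {..<2 * m})"
  have "card A \<le> m * m"
    unfolding A_def by (rule order_trans[OF card_image_le]) auto
  moreover have "card B \<le> p mod 2 * (2 * m)"
    unfolding B_def by (rule order_trans[OF card_image_le]) auto
  moreover have fin: "finite A" "finite B"
    by (auto simp: A_def B_def)
  have p_bounds: "2 * m \<le> p" "p \<le> 2 * m + 1"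
    by (simp_all add: m_def)
  have even_part: "rim_part p x = 2" if "even x" "x < 2 * m" for x
  proof -
    have "Suc x < 2 * m"
      using that by (auto elim!: evenE)
    with that p_bounds show ?thesis
      by (auto simp: rim_part_def)
  qed
  have "{rim p i, rim p j} \<in> A \<union> B" if "i < p" "j < p" "rim_part p i \<noteq> rim_part p j" "even i" for i j
  proof (cases "i = 2 * m \<or> j = 2 * m")
    case True
    then have p: "p = Suc (2 * m)"
      using that(1,2) p_bounds by linarith
    with True that consider "i = 2 * m" "j < 2 * m" | "j = 2 * m" "i < 2 * m"
      by (metis less_antisym)
    then have "{rim p i, rim p j} \<in> B"
      unfolding B_def
      by cases (use p in \<open>force simp: insert_commute\<close>)+
    then show ?thesis
      by simp
  next
    case False
    then have "i < 2 * m" "j < 2 * m"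
      using that(1,2) p_bounds by linarith+
    moreover have "odd j"
      using that(3,4) calculation even_part by metis
    ultimately obtain i' j' where "i = 2 * i'" "j = 2 * j' + 1" "i' < m" "j' < m"
      using \<open>even i\<close> by (auto elim!: evenE oddE)
    then have "{rim p i, rim p j} \<in> A"
      unfolding A_def by force
    then show ?thesis
      by simp
  qed
  note even = this
  have "{rim p i, rim p j} \<in> A \<union> B" if "i < p" "j < p" "rim_part p i \<noteq> rim_part p j" for i j
  proof -
    have "rim_part p x = 3" if "odd x" for x
      using that odd_iff_mod_2_eq_one[of x] by (simp add: rim_part_def)
    \<comment> \<open>All odd indices lie in part 3, so an edge has an end of even index, and by
      symmetry the case \<open>even i\<close> suffices.\<close>
    with that(3) have "even i \<or> even j"
      by metis
    with even[of i j] even[of j i] that show ?thesis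
      by (auto simp: insert_commute)
  qed
  then have "{{x, y} | x y. x \<in> rim p ` {..<p} \<and> y \<in> rim p ` {..<p} \<and> fst x \<noteq> fst y} \<subseteq> A \<union> B"
    by (auto simp: rim_def)
  from card_mono[OF _ this] fin
  have "card {{x, y} | x y. x \<in> rim p ` {..<p} \<and> y \<in> rim p ` {..<p} \<and> fst x \<noteq> fst y} \<le> card (A \<union> B)"
    by simp
  ultimately show ?thesis
    using card_Un_le[of A B] by linarith
qed

section \<open>The bound on the saturation number\<close>

lemma sat_multipartite_le:
  fixes k n p m :: nat
  assumes "k \<ge> 5" "p \<ge> 1" "n \<ge> p + 3"
  defines "m \<equiv> p div 2"
  shows "sat (complete_multipartite k n) (cycle (p + 4)) + 1
    \<le> k * n + k + p + m * m + (p mod 2) * (2 * m)"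
proof -
  interpret hub_graph "{..<k} \<times> {..<n}" "rim p ` {..<p}" fst "(0, 0)" "(1, 0)" "anchor k n"
    using assms by (intro hub_graph_multipartite)
  have "complete_multipartite k n = ({..<k} \<times> {..<n}, host)"
    unfolding complete_multipartite_def host_def by auto
  moreover have "card (rim p ` {..<p}) = p"
    using inj_rim by (simp add: card_image)
  ultimately have "sat (complete_multipartite k n) (cycle (p + 4)) \<le> card E"
    using saturated_hub_graph unfolding sat_def by (intro Least_le exI[of _ "(_, E)"]) auto
  moreover have "fst ` ({..<k} \<times> {..<n}) = {..<k}"
    using assms by (simp add: fst_image_times lessThan_empty_iff)
  ultimately show ?thesis
    using card_E_le card_inner_rim[of p] \<open>card (rim p ` {..<p}) = p\<close> assms
    by (simp add: inner_def card_cartesian_product)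
qed

theorem theorem1p4:
  fixes k l n :: nat
  assumes "k \<ge> l" and "l \<ge> 5"
    and "int n \<ge> \<lceil>(real k + real l - 2) / 2\<rceil>"
  shows "int (sat (complete_multipartite k n) (cycle l)) \<le>
           int k * int n + int k + int l - 5 + \<lfloor>(real l - 4) / 2\<rfloor>\<^sup>2
             + 2 * (int l - 4 - 2 * \<lfloor>(real l - 4) / 2\<rfloor>) * \<lfloor>(real l - 4) / 2\<rfloor>
       \<and> (odd l \<longrightarrow>
           real (sat (complete_multipartite k n) (cycle l)) \<le>
             real k * real n + real k + ((real l)\<^sup>2 - 2 * real l - 15) / 4)
       \<and> (even l \<longrightarrow>
           real (sat (complete_multipartite k n) (cycle l)) \<le>
             real k * real n + real k + ((real l)\<^sup>2 - 4 * real l - 4) / 4)"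
proof -
  define p m r where "p = l - 4" and "m = p div 2" and "r = p mod 2"
  define S where "S = sat (complete_multipartite k n) (cycle l)"
  have l: "l = p + 4" and p: "p \<ge> 1" and pm: "p = 2 * m + r"
    using assms(2) by (auto simp: p_def m_def r_def)
  have "(real k + real l - 2) / 2 \<le> real n"
    using assms(3) by (simp add: ceiling_le_iff)
  \<comment> \<open>By k \<ge> l the ceiling bound gives n \<ge> l - 1, the room needed for rim and
    anchors.\<close>
  then have "n \<ge> p + 3"
    using assms(1) l by (simp add: field_simps)
  then have S: "S + 1 \<le> k * n + k + p + m * m + r * (2 * m)"
    using sat_multipartite_le[of k p n] assms(1,2) p by (simp add: S_def l m_def r_def)
  have floor: "\<lfloor>(real l - 4) / 2\<rfloor> = int m"
    using floor_divide_of_nat_eq[of p 2] by (simp add: l m_def)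
  have "int (S + 1) \<le> int (k * n + k + p + m * m + r * (2 * m))"
    using S by (simp only: of_nat_le_iff)
  then have "int S \<le> int k * int n + int k + int l - 5 + (int m)\<^sup>2
      + 2 * (int l - 4 - 2 * int m) * int m"
    by (simp add: l pm power2_eq_square algebra_simps)
  moreover have real_S: "real (S + 1) \<le> real (k * n + k + p + m * m + r * (2 * m))"
    using S by (simp only: of_nat_le_iff)
  have "real S \<le> real k * real n + real k + ((real l)\<^sup>2 - 2 * real l - 15) / 4" if "odd l"
  proof -
    have "r = 1"
      using that odd_iff_mod_2_eq_one[of p] by (simp add: l r_def)
    with real_S show ?thesis
      by (simp add: l pm power2_eq_square field_simps)
  qed
  moreover have "real S \<le> real k * real n + real k + ((real l)\<^sup>2 - 4 * real l - 4) / 4" if "even l"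
  proof -
    have "r = 0"
      using that by (simp add: l r_def)
    with real_S show ?thesis
      by (simp add: l pm power2_eq_square field_simps)
  qed
  ultimately show ?thesis
    unfolding floor S_def by blast
qed

end
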